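(* Let $\mathcal{H}$ be a non-trivial complex Hilbert space, let $A\in\mathcal{B}(\mathcal{H})$ be a positive operator, and let $T\in \mathcal{B}_A(\mathcal{H})$. Then $$w_A(T)\geq \sqrt{\|\mathrm{Im}_A(T)\|_A^2+ m_A^2(\mathrm{Re}_A(T))}.$$
   Context: $\mathcal{B}(\mathcal{H})$ is the algebra of bounded linear operators on the complex Hilbert space $(\mathcal{H},\langle\cdot,\cdot\rangle)$. $A\in\mathcal{B}(\mathcal{H})$ is positive if $\langle Ax,x\rangle\ge 0$ for all $x\in\mathcal{H}$. Put $\langle x,y\rangle_A=\langle Ax,y\rangle$ and $\|x\|_A=\sqrt{\langle x,x\rangle_A}$ (a semi-norm). $\mathcal{B}_A(\mathcal{H})$ is the set of $T\in\mathcal{B}(\mathcal{H})$ that admit an $A$-adjoint, i.e. some $R\in\mathcal{B}(\mathcal{H})$ with $AR=T^*A$; equivalently $\mathcal{R}(T^*A)\subseteq\mathcal{R}(A)$, where $\mathcal{R}$ denotes range. For $T\in\mathcal{B}_A(\mathcal{H})$, $T^{\sharp_A}=A^{\dagger}T^*A$ ($A^\dagger$ the Moore–Penrose inverse of $A$) is the reduced solution of $AX=T^*A$, i.e. the unique $X\in\mathcal{B}(\mathcal{H})$ with $AX=T^*A$ and $\mathcal{R}(X)\subseteq\overline{\mathcal{R}(A)}$. For such operators, $\|T\|_A=\sup\{\|Tx\|_A/\|x\|_A : x\in\overline{\mathcal{R}(A)},\,x\ne 0\}$ (finite). Further, $W_A(T)=\{\langle Tx,x\rangle_A: x\in\mathcal{H},\|x\|_A=1\}$,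 $w_A(T)=\sup\{|\lambda|:\lambda\in W_A(T)\}$ ($A$-numerical radius), $m_A(T)=\inf\{|\lambda|:\lambda\in W_A(T)\}$ ($A$-Crawford number), and $m_A^2(\cdot)$ means $(m_A(\cdot))^2$. Finally $\mathrm{Re}_A(T)=\frac12(T+T^{\sharp_A})$ and $\mathrm{Im}_A(T)=\frac1{2i}(T-T^{\sharp_A})$. *)

theory Defs
  imports "HOL-Analysis.Analysis"
begin

text \<open>
  Complex Hilbert spaces. The real normed structure (and with it the topology) comes from the
  library; it is tied to the complex structure by \<open>scaleR_scaleC\<close> and \<open>norm_eq_sqrt_cinner\<close>.
  The inner product is linear in its first argument.
\<close>

class complex_inner = real_normed_vector +
  fixes scaleC :: "complex \<Rightarrow> 'a \<Rightarrow> 'a" (infixr \<open>*\<^sub>C\<close> 75)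
    and cinner :: "'a \<Rightarrow> 'a \<Rightarrow> complex"
  assumes scaleC_add_right: "c *\<^sub>C (x + y) = c *\<^sub>C x + c *\<^sub>C y"
    and scaleC_add_left: "(c + d) *\<^sub>C x = c *\<^sub>C x + d *\<^sub>C x"
    and scaleC_scaleC: "c *\<^sub>C (d *\<^sub>C x) = (c * d) *\<^sub>C x"
    and scaleC_one: "1 *\<^sub>C x = x"
    and scaleR_scaleC: "r *\<^sub>R x = complex_of_real r *\<^sub>C x"
    and cinner_commute: "cinner x y = cnj (cinner y x)"
    and cinner_add_left: "cinner (x + y) z = cinner x z + cinner y z"
    and cinner_scaleC_left: "cinner (c *\<^sub>C x) y = c * cinner x y"
    and cinner_nonneg: "cinner x x \<in> \<real>\<^sub>\<ge>\<^sub>0"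
    and cinner_eq_zero_iff: "cinner x x = 0 \<longleftrightarrow> x = 0"
    and norm_eq_sqrt_cinner: "norm x = sqrt (Re (cinner x x))"

class chilbert_space = complex_inner + banach

instantiation complex :: chilbert_space
begin

definition scaleC_complex :: "complex \<Rightarrow> complex \<Rightarrow> complex"
  where "scaleC_complex c x = c * x"

definition cinner_complex :: "complex \<Rightarrow> complex \<Rightarrow> complex"
  where "cinner_complex x y = x * cnj y"

instance
proof
  fix x :: complex
  show "cinner x x \<in> \<real>\<^sub>\<ge>\<^sub>0"
    unfolding cinner_complex_def complex_mult_cnj by (simp add: complex_nonneg_Reals_iff)
  show "norm x = sqrt (Re (cinner x x))"
    unfolding cinner_complex_def complex_mult_cnj by (simp add: cmod_def)
qed (simp_all add: scaleC_complex_def cinner_complex_def algebra_simps scaleR_conv_of_real)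

end

definition bounded_clinear :: "('a::complex_inner \<Rightarrow> 'b::complex_inner) \<Rightarrow> bool"
  where "bounded_clinear T \<longleftrightarrow> bounded_linear T \<and> (\<forall>c x. T (c *\<^sub>C x) = c *\<^sub>C T x)"

definition cadjoint :: "('a::chilbert_space \<Rightarrow> 'a) \<Rightarrow> 'a \<Rightarrow> 'a"
  where "cadjoint T = (THE S. bounded_clinear S \<and> (\<forall>x y. cinner (T x) y = cinner x (S y)))"

definition positive_op :: "('a::chilbert_space \<Rightarrow> 'a) \<Rightarrow> bool"
  where "positive_op A \<longleftrightarrow> bounded_clinear A \<and> (\<forall>x. cinner (A x) x \<in> \<real>\<^sub>\<ge>\<^sub>0)"

definition A_inner :: "('a::chilbert_space \<Rightarrow> 'a) \<Rightarrow> 'a \<Rightarrow> 'a \<Rightarrow> complex"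
  where "A_inner A x y = cinner (A x) y"

definition A_seminorm :: "('a::chilbert_space \<Rightarrow> 'a) \<Rightarrow> 'a \<Rightarrow> real"
  where "A_seminorm A x = sqrt (Re (A_inner A x x))"

definition A_adjointable :: "('a::chilbert_space \<Rightarrow> 'a) \<Rightarrow> ('a \<Rightarrow> 'a) set"
  where "A_adjointable A =
    {T. bounded_clinear T \<and> (\<exists>R. bounded_clinear R \<and> A \<circ> R = cadjoint T \<circ> A)}"

text \<open>The reduced solution of \<open>A X = T\<^sup>* A\<close>, i.e. \<open>A\<^sup>\<dagger> T\<^sup>* A\<close> with the Moore-Penrose inverse \<open>A\<^sup>\<dagger>\<close>.\<close>

definition A_sharp :: "('a::chilbert_space \<Rightarrow> 'a) \<Rightarrow> ('a \<Rightarrow> 'a) \<Rightarrow> 'a \<Rightarrow> 'a"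
  where "A_sharp A T =
    (THE X. bounded_clinear X \<and> A \<circ> X = cadjoint T \<circ> A \<and> range X \<subseteq> closure (range A))"

definition Re_A :: "('a::chilbert_space \<Rightarrow> 'a) \<Rightarrow> ('a \<Rightarrow> 'a) \<Rightarrow> 'a \<Rightarrow> 'a"
  where "Re_A A T = (\<lambda>x. (1 / 2) *\<^sub>C (T x + A_sharp A T x))"

definition Im_A :: "('a::chilbert_space \<Rightarrow> 'a) \<Rightarrow> ('a \<Rightarrow> 'a) \<Rightarrow> 'a \<Rightarrow> 'a"
  where "Im_A A T = (\<lambda>x. (1 / (2 * \<i>)) *\<^sub>C (T x - A_sharp A T x))"

definition A_numerical_range :: "('a::chilbert_space \<Rightarrow> 'a) \<Rightarrow> ('a \<Rightarrow> 'a) \<Rightarrow> complex set"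
  where "A_numerical_range A T = {A_inner A (T x) x | x. A_seminorm A x = 1}"

text \<open>
  In the degenerate case \<open>A = 0\<close> the supremum and infimum below range over the empty set, where
  the library leaves \<open>Sup\<close> and \<open>Inf\<close> on the reals unspecified; all three quantities are then
  set to \<open>0\<close>.
\<close>

definition A_norm :: "('a::chilbert_space \<Rightarrow> 'a) \<Rightarrow> ('a \<Rightarrow> 'a) \<Rightarrow> real"
  where "A_norm A T =
    (let Q = {A_seminorm A (T x) / A_seminorm A x | x. x \<in> closure (range A) \<and> x \<noteq> 0}
     in if Q = {} then 0 else Sup Q)"

definition A_numerical_radius :: "('a::chilbert_space \<Rightarrow> 'a) \<Rightarrow> ('a \<Rightarrow> 'a) \<Rightarrow> real"
  where "A_numerical_radius A T =
    (if A_numerical_range A T = {} then 0 else (SUP z\<in>A_numerical_range A T. cmod z))"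

definition A_crawford :: "('a::chilbert_space \<Rightarrow> 'a) \<Rightarrow> ('a \<Rightarrow> 'a) \<Rightarrow> real"
  where "A_crawford A T =
    (if A_numerical_range A T = {} then 0 else (INF z\<in>A_numerical_range A T. cmod z))"

end

theory Submission
  imports Defs
begin

text \<open>
  For \<open>\<parallel>x\<parallel>\<^sub>A = 1\<close> the numbers \<open>\<langle>Re\<^sub>A(T) x, x\<rangle>\<^sub>A\<close> and \<open>\<langle>Im\<^sub>A(T) x, x\<rangle>\<^sub>A\<close> are the real and imaginary
  parts of \<open>\<langle>T x, x\<rangle>\<^sub>A\<close>, so that \<open>\<langle>Im\<^sub>A(T) x, x\<rangle>\<^sub>A\<^sup>2 \<le> w\<^sub>A(T)\<^sup>2 - m\<^sub>A(Re\<^sub>A(T))\<^sup>2\<close>. The operator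
  \<open>Im\<^sub>A(T)\<close> is symmetric for the semi-inner product, and by polarization the seminorm of a
  symmetric operator is bounded by its numerical radius. That \<open>w\<^sub>A(T)\<close> is finite rests on the
  log-convexity of \<open>k \<mapsto> \<parallel>S\<^sup>k x\<parallel>\<^sub>A\<close> for the symmetric operator \<open>S = T\<^sup>\<sharp> T\<close>. The existence of
  \<open>T\<^sup>*\<close> and \<open>T\<^sup>\<sharp>\<close> follows from the projection theorem.
\<close>

section \<open>Semi-inner products\<close>

text \<open>Stated without definiteness, so that one set of lemmas serves both \<open>cinner\<close>
  and \<open>A_inner A\<close>.\<close>

locale semi_inner =
  fixes f :: "'a::complex_inner \<Rightarrow> 'a \<Rightarrow> complex"
  assumes add_left: "f (x + y) z = f x z + f y z"
    and scale_left: "f (c *\<^sub>C x) y = c * f x y"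
    and commute: "f x y = cnj (f y x)"
    and nonneg: "0 \<le> Re (f x x)"
begin

lemma add_right: "f x (y + z) = f x y + f x z"
  by (metis add_left commute complex_cnj_add)

lemma scale_right: "f x (c *\<^sub>C y) = cnj c * f x y"
  by (metis scale_left commute complex_cnj_mult)

lemma minus_left: "f (- x) y = - f x y"
proof -
  have "- x = complex_of_real (- 1) *\<^sub>C x"
    by (metis scaleR_minus1_left scaleR_scaleC)
  then show ?thesis by (simp add: scale_left)
qed

lemma minus_right: "f x (- y) = - f x y"
  by (metis minus_left commute complex_cnj_minus)

lemma diff_left: "f (x - y) z = f x z - f y z"
  using add_left[of x "- y"] by (simp add: minus_left)

lemma diff_right: "f x (y - z) = f x y - f x z"
  using add_right[of x y "- z"] by (simp add: minus_right)

lemma zero_left: "f 0 x = 0"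
  using add_left[of 0 0] by simp

lemma zero_right: "f x 0 = 0"
  using add_right[of x 0 0] by simp

lemma Im_self: "Im (f x x) = 0"
  by (metis commute Reals_cnj_iff complex_is_Real_iff)

section \<open>The Cauchy-Schwarz inequality and the seminorm\<close>

lemma Re_add_scaleR:
  "Re (f (x + t *\<^sub>R y) (x + t *\<^sub>R y)) = Re (f x x) + 2 * t * Re (f x y) + t\<^sup>2 * Re (f y y)"
proof -
  have "Re (f y x) = Re (f x y)"
    by (metis commute complex_cnj(1) complex.sel(1) complex_surj)
  then show ?thesis
    by (simp add: add_left add_right scale_left scale_right scaleR_scaleC algebra_simps power2_eq_square)
qed

text \<open>The form at \<open>x + t *\<^sub>R y\<close> is a quadratic in the real \<open>t\<close>
  that is never negative. If \<open>c\<close> is positive, its value at the minimiser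
  \<open>- b / c\<close> gives the claim.\<close>

lemma Re_cauchy_schwarz: "(Re (f x y))\<^sup>2 \<le> Re (f x x) * Re (f y y)"
proof -
  define a b c where "a = Re (f x x)" and "b = Re (f x y)" and "c = Re (f y y)"
  have q: "0 \<le> a + 2 * t * b + t\<^sup>2 * c" for t
    unfolding a_def b_def c_def using nonneg Re_add_scaleR by metis
  have "b\<^sup>2 \<le> a * c"
  proof (cases "c = 0")
    case True
    have "b = 0"
    proof (rule ccontr)
      assume "b \<noteq> 0"
      \<comment> \<open>With \<open>c = 0\<close> the expression is affine in \<open>t\<close>, and
        at this \<open>t\<close> it equals \<open>-1\<close>.\<close>
      then show False using q[of "- (a + 1) / (2 * b)"] True by (simp add: field_simps)
    qed
    then show ?thesis using True by simp
  next
    case False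
    then have "c > 0" using nonneg[of y] by (simp add: c_def)
    then show ?thesis using q[of "- b / c"] by (simp add: field_simps power2_eq_square)
  qed
  then show ?thesis by (simp add: a_def b_def c_def)
qed

text \<open>Multiplying \<open>x\<close> by the unimodular \<open>c\<close> rotates
  \<open>f x y\<close> onto the nonnegative real axis and preserves \<open>f x x\<close>, so the
  bound on the real part suffices.\<close>

lemma cauchy_schwarz_squared: "(cmod (f x y))\<^sup>2 \<le> Re (f x x) * Re (f y y)"
proof (cases "f x y = 0")
  case True
  then show ?thesis by (simp add: nonneg)
next
  case False
  define c where "c = cnj (sgn (f x y))"
  have c: "c * f x y = complex_of_real (cmod (f x y))" "c * cnj c = 1"
    using False by (simp_all add: c_def sgn_eq complex_norm_square[symmetric] divide_simps
        power2_eq_square mult.commute)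
  have "f (c *\<^sub>C x) y = complex_of_real (cmod (f x y))"
    by (simp add: scale_left c)
  moreover have "f (c *\<^sub>C x) (c *\<^sub>C x) = f x x"
    using c(2) by (simp add: scale_left scale_right mult.assoc[symmetric] mult.commute)
  ultimately show ?thesis
    using Re_cauchy_schwarz[of "c *\<^sub>C x" y] by simp
qed

definition seminorm :: "'a \<Rightarrow> real"
  where "seminorm x = sqrt (Re (f x x))"

lemma seminorm_nonneg: "0 \<le> seminorm x"
  by (simp add: seminorm_def nonneg)

lemma seminorm_squared: "(seminorm x)\<^sup>2 = Re (f x x)"
  by (simp add: seminorm_def nonneg)

lemma self_eq_seminorm: "f x x = complex_of_real ((seminorm x)\<^sup>2)"
  by (simp add: seminorm_squared complex_eq_iff Im_self)

lemma cauchy_schwarz: "cmod (f x y) \<le> seminorm x * seminorm y"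
  using real_le_rsqrt[OF cauchy_schwarz_squared] by (simp add: seminorm_def real_sqrt_mult)

lemma seminorm_scaleR: "seminorm (r *\<^sub>R x) = \<bar>r\<bar> * seminorm x"
proof -
  have "Re (f (r *\<^sub>R x) (r *\<^sub>R x)) = r\<^sup>2 * Re (f x x)"
    by (simp add: scaleR_scaleC scale_left scale_right power2_eq_square)
  then show ?thesis by (simp add: seminorm_def real_sqrt_mult)
qed

section \<open>The parallelogram law and symmetric operators\<close>

lemma parallelogram:
  "(seminorm (x + y))\<^sup>2 + (seminorm (x - y))\<^sup>2 = 2 * (seminorm x)\<^sup>2 + 2 * (seminorm y)\<^sup>2"
  by (simp add: seminorm_squared add_left add_right diff_left diff_right)

text \<open>Polarization writes \<open>4 * Re (f (S x) y)\<close> as the difference of the quadratic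
  forms at \<open>x + y\<close> and \<open>x - y\<close>, and the parallelogram law adds up their
  bounds. Taking \<open>y\<close> as a real multiple of \<open>S x\<close> then isolates the
  seminorm of \<open>S x\<close>.\<close>

lemma seminorm_le_if_numerical_le:
  assumes S: "\<And>x y. f (S x) y = f x (S y)"
    and add: "\<And>x y. S (x + y) = S x + S y"
    and bound: "\<And>x. \<bar>Re (f (S x) x)\<bar> \<le> M * (seminorm x)\<^sup>2"
  shows "seminorm (S x) \<le> M * seminorm x"
proof -
  have diff: "S (x - y) = S x - S y" for x y
    using add[of "x - y" y] by simp
  have polar: "4 * Re (f (S x) y) \<le> 2 * M * ((seminorm x)\<^sup>2 + (seminorm y)\<^sup>2)" for x y
  proof -
    have "Re (f (S y) x) = Re (f (S x) y)"
      by (metis S commute complex_cnj(1) complex.sel(1) complex_surj)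
    then have "4 * Re (f (S x) y) = Re (f (S (x + y)) (x + y)) - Re (f (S (x - y)) (x - y))"
      by (simp add: add diff add_left add_right diff_left diff_right)
    also have "\<dots> \<le> M * (seminorm (x + y))\<^sup>2 + M * (seminorm (x - y))\<^sup>2"
      using bound[of "x + y"] bound[of "x - y"] by linarith
    also have "\<dots> = M * ((seminorm (x + y))\<^sup>2 + (seminorm (x - y))\<^sup>2)"
      by (simp add: algebra_simps)
    also have "\<dots> = 2 * M * ((seminorm x)\<^sup>2 + (seminorm y)\<^sup>2)"
      unfolding parallelogram by (simp add: algebra_simps)
    finally show ?thesis .
  qed
  define r s where "r = seminorm x" and "s = seminorm (S x)"
  have nn: "0 \<le> r" "0 \<le> s" by (simp_all add: r_def s_def seminorm_nonneg)
  have scaled: "4 * t * s\<^sup>2 \<le> 2 * M * (r\<^sup>2 + t\<^sup>2 * s\<^sup>2)" for t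
    using polar[of x "t *\<^sub>R S x"]
    by (simp add: scaleR_scaleC[of t] scale_right seminorm_scaleR[unfolded scaleR_scaleC] r_def s_def
        seminorm_squared power_mult_distrib)
  have "s \<le> M * r"
  proof (cases "s = 0 \<or> r = 0")
    case True
    \<comment> \<open>Symmetry and Cauchy-Schwarz force \<open>s = 0\<close> when
      \<open>r = 0\<close>. So \<open>s = 0\<close> throughout this case, and
      \<open>0 \<le> M * r\<close> remains, which comes from \<open>bound\<close>.\<close>
    have "s\<^sup>2 = Re (f x (S (S x)))"
      by (simp add: s_def seminorm_squared S)
    also have "\<dots> \<le> r * seminorm (S (S x))"
      using cauchy_schwarz[of x "S (S x)"] complex_Re_le_cmod[of "f x (S (S x))"]
      by (simp add: r_def)
    finally have z: "r = 0 \<Longrightarrow> s = 0" by simp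
    have "0 \<le> M * r"
    proof (cases "r = 0")
      case False
      have "0 \<le> M * r * r"
        using bound[of x] by (simp add: r_def power2_eq_square mult.assoc)
      then show ?thesis using False nn by (simp add: zero_le_mult_iff)
    qed simp
    then show ?thesis using True z by auto
  next
    case False
    then have pos: "0 < r" "0 < s" using nn by auto
    \<comment> \<open>The choice \<open>t = r / s\<close> makes the two summands on the right of
      \<open>scaled\<close> equal.\<close>
    have "4 * (r / s) * s\<^sup>2 = 4 * r * s" "(r / s)\<^sup>2 * s\<^sup>2 = r\<^sup>2"
      using pos by (simp_all add: power2_eq_square)
    then have "4 * r * s \<le> 4 * r * (M * r)"
      using scaled[of "r / s"] by (simp add: power2_eq_square algebra_simps)
    then show ?thesis using pos by simp
  qed
  then show ?thesis by (simp add: r_def s_def)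
qed

text \<open>Moving one \<open>S\<close> across the form shows that the seminorms of
  \<open>(S ^^ n) x\<close> are log-convex in \<open>n\<close>. Hence they grow at least like the
  powers of the first one, which is compared with \<open>C * K ^ n\<close> for large
  \<open>n\<close>. Only the rate \<open>K\<close> survives, so \<open>C\<close> may depend on
  \<open>x\<close>.\<close>

lemma seminorm_symmetric_bound:
  assumes S: "\<And>x y. f (S x) y = f x (S y)"
    and growth: "\<And>n. seminorm ((S ^^ n) x) \<le> C * K ^ n"
    and K: "0 < K" and x: "seminorm x = 1"
  shows "seminorm (S x) \<le> K"
proof (rule ccontr)
  define a where "a n = seminorm ((S ^^ n) x)" for n
  have nn: "0 \<le> a n" for n by (simp add: a_def seminorm_nonneg)
  have a0: "a 0 = 1" by (simp add: a_def x)
  have conv: "(a (Suc k))\<^sup>2 \<le> a k * a (Suc (Suc k))" for k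
  proof -
    have "(a (Suc k))\<^sup>2 = Re (f ((S ^^ k) x) ((S ^^ Suc (Suc k)) x))"
      by (simp add: a_def seminorm_squared S)
    also have "\<dots> \<le> a k * a (Suc (Suc k))"
      unfolding a_def
      using cauchy_schwarz complex_Re_le_cmod order_trans by blast
    finally show ?thesis .
  qed
  \<comment> \<open>The successive ratios are at least the first one, written as a product to allow
    for zero terms.\<close>
  have step: "a 1 * a k \<le> a (Suc k)" for k
  proof (induction k)
    case 0
    then show ?case by (simp add: a0)
  next
    case (Suc k)
    show ?case
    proof (cases "a (Suc k) = 0")
      case True
      then show ?thesis by (simp add: nn)
    next
      case False
      have "a (Suc k) * (a 1 * a (Suc k)) \<le> a 1 * (a k * a (Suc (Suc k)))"
        using mult_left_mono[OF conv[of k] nn[of 1]] by (simp add: power2_eq_square algebra_simps)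
      also have "\<dots> \<le> a (Suc k) * a (Suc (Suc k))"
        using mult_right_mono[OF Suc nn[of "Suc (Suc k)"]] by (simp add: mult.assoc)
      finally show ?thesis using False nn[of "Suc k"] by simp
    qed
  qed
  have pow: "(a 1) ^ n \<le> a n" for n
  proof (induction n)
    case 0
    then show ?case by (simp add: a0)
  next
    case (Suc n)
    then show ?case
      using step[of n] mult_left_mono[OF Suc nn[of 1]] by simp
  qed
  assume "\<not> seminorm (S x) \<le> K"
  then have "1 < a 1 / K" using K by (simp add: a_def)
  then obtain n where n: "C < (a 1 / K) ^ n"
    using real_arch_pow by blast
  have "(a 1) ^ n \<le> C * K ^ n"
    using pow[of n] growth[of n] by (simp add: a_def)
  then show False
    using n K by (simp add: power_divide field_simps)
qed

end

section \<open>Hilbert spaces\<close>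

interpretation cinner: semi_inner "cinner :: 'a::complex_inner \<Rightarrow> 'a \<Rightarrow> complex"
  rewrites seminorm_cinner: "semi_inner.seminorm (cinner :: 'a \<Rightarrow> 'a \<Rightarrow> complex) = norm"
proof -
  show *: "semi_inner (cinner :: 'a \<Rightarrow> 'a \<Rightarrow> complex)"
    using cinner_nonneg
    by unfold_locales
      (auto simp: cinner_add_left cinner_scaleC_left cinner_commute[symmetric] complex_nonneg_Reals_iff)
  show "semi_inner.seminorm (cinner :: 'a \<Rightarrow> 'a \<Rightarrow> complex) = norm"
    by (rule ext) (simp add: semi_inner.seminorm_def[OF *] norm_eq_sqrt_cinner)
qed

lemma norm_scaleC: "norm (c *\<^sub>C x) = cmod c * norm (x::'a::complex_inner)"
proof -
  have "complex_of_real ((norm (c *\<^sub>C x))\<^sup>2) = complex_of_real ((cmod c * norm x)\<^sup>2)"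
    unfolding power_mult_distrib of_real_mult complex_norm_square cinner.self_eq_seminorm[symmetric]
    by (simp add: cinner.scale_left cinner.scale_right)
  then show ?thesis
    using of_real_eq_iff power2_eq_imp_eq by (metis norm_ge_zero mult_nonneg_nonneg)
qed

lemma bounded_linear_scaleC: "bounded_linear (\<lambda>x::'a::complex_inner. c *\<^sub>C x)"
proof (rule bounded_linear_intro)
  show "c *\<^sub>C (r *\<^sub>R x) = r *\<^sub>R c *\<^sub>C x" for r and x :: 'a
    by (simp add: scaleR_scaleC scaleC_scaleC mult.commute)
  show "norm (c *\<^sub>C x) \<le> norm x * cmod c" for x :: 'a
    by (simp add: norm_scaleC mult.commute)
qed (rule scaleC_add_right)

lemma cinner_eqI: "(\<And>x. cinner x y = cinner x z) \<Longrightarrow> y = z"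
  by (metis cinner.diff_right cinner_eq_zero_iff eq_iff_diff_eq_0)

lemma bounded_clinear_intro:
  assumes "\<And>x y. F (x + y) = F x + F y" "\<And>c x. F (c *\<^sub>C x) = c *\<^sub>C F x"
    and "\<And>x. norm (F x) \<le> norm x * K"
  shows "bounded_clinear F"
  unfolding bounded_clinear_def using assms
  by (auto intro!: bounded_linear_intro simp: scaleR_scaleC)

lemma bounded_clinearD:
  assumes "bounded_clinear F"
  shows "F (x + y) = F x + F y" "F (x - y) = F x - F y" "F (c *\<^sub>C x) = c *\<^sub>C F x"
    "bounded_linear F"
  using assms linear_simps[of F] by (auto simp: bounded_clinear_def)

lemma bounded_clinear_compose:
  "bounded_clinear F \<Longrightarrow> bounded_clinear G \<Longrightarrow> bounded_clinear (\<lambda>x. F (G x))"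
  by (auto simp: bounded_clinear_def intro: bounded_linear_compose)

section \<open>Closed subspaces, the projection theorem, Riesz representation and adjoints\<close>

definition csubspace :: "'a::complex_inner set \<Rightarrow> bool"
  where "csubspace V \<longleftrightarrow> 0 \<in> V \<and> (\<forall>x\<in>V. \<forall>y\<in>V. x + y \<in> V) \<and> (\<forall>c. \<forall>x\<in>V. c *\<^sub>C x \<in> V)"

lemma csubspaceD:
  assumes "csubspace V"
  shows "0 \<in> V" "x \<in> V \<Longrightarrow> y \<in> V \<Longrightarrow> x + y \<in> V" "x \<in> V \<Longrightarrow> c *\<^sub>C x \<in> V"
    "x \<in> V \<Longrightarrow> y \<in> V \<Longrightarrow> x - y \<in> V"
proof -
  show "x - y \<in> V" if "x \<in> V" "y \<in> V"
  proof -
    have "complex_of_real (- 1) *\<^sub>C y = - y"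
      by (metis scaleR_minus1_left scaleR_scaleC)
    then show ?thesis
      using assms that unfolding csubspace_def by (metis add_uminus_conv_diff)
  qed
qed (use assms in \<open>auto simp: csubspace_def\<close>)

lemma csubspace_closure_range:
  assumes "bounded_clinear F"
  shows "csubspace (closure (range F))"
  unfolding csubspace_def
proof (intro conjI ballI allI)
  note F = bounded_clinearD[OF assms]
  have "F 0 = 0" using F(4) by (simp add: linear_simps)
  then show "0 \<in> closure (range F)"
    using closure_subset by (metis rangeI subsetD)
next
  note F = bounded_clinearD[OF assms]
  fix x y assume "x \<in> closure (range F)" "y \<in> closure (range F)"
  then obtain u v where "\<And>n. u n \<in> range F" "u \<longlonglongrightarrow> x" "\<And>n. v n \<in> range F" "v \<longlonglongrightarrow> y"
    unfolding closure_sequential by metis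
  then have "\<And>n. u n + v n \<in> range F" "(\<lambda>n. u n + v n) \<longlonglongrightarrow> x + y"
    by (auto intro: tendsto_add simp: image_iff) (metis F(1))
  then show "x + y \<in> closure (range F)"
    unfolding closure_sequential by (intro exI[of _ "\<lambda>n. u n + v n"]) simp
next
  note F = bounded_clinearD[OF assms]
  fix c x assume "x \<in> closure (range F)"
  then obtain u where "\<And>n. u n \<in> range F" "u \<longlonglongrightarrow> x"
    unfolding closure_sequential by metis
  then have "\<And>n. c *\<^sub>C u n \<in> range F"
    by (auto simp: image_iff) (metis F(3))
  moreover have "(\<lambda>n. c *\<^sub>C u n) \<longlonglongrightarrow> c *\<^sub>C x"
    by (rule bounded_linear.tendsto[OF bounded_linear_scaleC \<open>u \<longlonglongrightarrow> x\<close>])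
  ultimately show "c *\<^sub>C x \<in> closure (range F)"
    unfolding closure_sequential by (intro exI[of _ "\<lambda>n. c *\<^sub>C u n"]) simp
qed

text \<open>Subtracting the component of \<open>z\<close> along \<open>s\<close> lowers the squared
  norm by \<open>(cmod (cinner z s))\<^sup>2 / N\<close>, which minimality permits only if this is
  zero.\<close>

lemma orthogonal_if_minimal:
  fixes z s :: "'a::complex_inner"
  assumes "\<And>c. norm z \<le> norm (z - c *\<^sub>C s)"
  shows "cinner z s = 0"
proof (cases "s = 0")
  case True
  then show ?thesis by (simp add: cinner.zero_right)
next
  case False
  define N where "N = (norm s)\<^sup>2"
  have N: "0 < N" "cinner s s = complex_of_real N"
    using False by (simp_all add: N_def cinner.self_eq_seminorm)
  define c where "c = cinner z s / N"
  have "cinner s z = cnj (cinner z s)"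
    by (rule cinner_commute)
  then have "cinner (z - c *\<^sub>C s) (z - c *\<^sub>C s) = cinner z z - complex_of_real ((cmod (cinner z s))\<^sup>2 / N)"
    using N(1) unfolding c_def of_real_divide complex_norm_square
    by (simp add: cinner.diff_left cinner.diff_right cinner.scale_left cinner.scale_right N(2)
        field_simps)
  then have "(norm (z - c *\<^sub>C s))\<^sup>2 = (norm z)\<^sup>2 - (cmod (cinner z s))\<^sup>2 / N"
    unfolding cinner.seminorm_squared by simp
  moreover have "(norm z)\<^sup>2 \<le> (norm (z - c *\<^sub>C s))\<^sup>2"
    by (simp add: assms power_mono)
  ultimately have "(cmod (cinner z s))\<^sup>2 / N \<le> 0" by simp
  then show ?thesis using N(1) by (simp add: divide_le_0_iff)
qed

text \<open>A minimizing sequence is Cauchy: midpoints stay in \<open>V\<close>, so by the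
  parallelogram law two nearly minimal points are close to each other.\<close>

lemma nearest_point_exists:
  fixes x :: "'a::chilbert_space"
  assumes "closed V" "csubspace V"
  shows "\<exists>p\<in>V. \<forall>v\<in>V. norm (x - p) \<le> norm (x - v)"
proof -
  define D where "D = (INF v\<in>V. (norm (x - v))\<^sup>2)"
  have ne: "V \<noteq> {}" using csubspaceD(1)[OF assms(2)] by auto
  have bdd: "bdd_below ((\<lambda>v. (norm (x - v))\<^sup>2) ` V)"
    by (rule bdd_belowI2[of _ 0]) simp
  have D: "D \<le> (norm (x - v))\<^sup>2" if "v \<in> V" for v
    unfolding D_def using bdd that by (rule cINF_lower)
  have "\<exists>v\<in>V. (norm (x - v))\<^sup>2 < D + inverse (real (Suc n))" for n
    using cINF_less_iff[OF ne bdd, of "D + inverse (real (Suc n))"] by (simp add: D_def)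
  then obtain y where y: "\<And>n. y n \<in> V" "\<And>n. (norm (x - y n))\<^sup>2 < D + inverse (real (Suc n))"
    by metis
  have dist: "(norm (y m - y n))\<^sup>2 \<le> 2 * inverse (real (Suc m)) + 2 * inverse (real (Suc n))" for m n
  proof -
    \<comment> \<open>Since the midpoint \<open>q\<close> lies in \<open>V\<close>, the sum term of
      the parallelogram law is at least \<open>4 * D\<close> and cancels the \<open>4 * D\<close>
      contributed by the two nearly minimal distances.\<close>
    define q where "q = complex_of_real (1 / 2) *\<^sub>C (y m + y n)"
    have "q \<in> V" unfolding q_def using y(1) csubspaceD[OF assms(2)] by blast
    moreover have "(x - y n) + (x - y m) = 2 *\<^sub>R (x - q)"
      unfolding q_def scaleR_scaleC[symmetric] by (simp add: algebra_simps scaleR_2)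
    ultimately have "4 * D \<le> (norm ((x - y n) + (x - y m)))\<^sup>2"
      using D[of q] by (simp add: power_mult_distrib)
    moreover have "(x - y n) - (x - y m) = y m - y n" by simp
    ultimately show ?thesis
      using cinner.parallelogram[of "x - y n" "x - y m"] y(2)[of n] y(2)[of m] by simp
  qed
  have "Cauchy y"
  proof (rule metric_CauchyI)
    fix e :: real assume e: "0 < e"
    then obtain N where N: "inverse (real (Suc N)) < e\<^sup>2 / 4"
      using reals_Archimedean[of "e\<^sup>2 / 4"] by auto
    have "dist (y m) (y n) < e" if "N \<le> m" "N \<le> n" for m n
    proof -
      have "inverse (real (Suc m)) \<le> inverse (real (Suc N))"
        "inverse (real (Suc n)) \<le> inverse (real (Suc N))"
        using that by (auto intro!: le_imp_inverse_le)
      then have "(norm (y m - y n))\<^sup>2 < e\<^sup>2"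
        using dist[of m n] N by linarith
      then show ?thesis
        using e by (simp add: dist_norm power2_less_imp_less)
    qed
    then show "\<exists>M. \<forall>m\<ge>M. \<forall>n\<ge>M. dist (y m) (y n) < e" by blast
  qed
  then obtain p where p: "y \<longlonglongrightarrow> p"
    using Cauchy_convergent convergent_def by blast
  have "p \<in> V" using assms(1) y(1) p closed_sequentially by blast
  have "(\<lambda>n. (norm (x - y n))\<^sup>2) \<longlonglongrightarrow> (norm (x - p))\<^sup>2"
    by (intro tendsto_intros p)
  moreover have "(\<lambda>n. D + inverse (real (Suc n))) \<longlonglongrightarrow> D + 0"
    by (intro tendsto_intros LIMSEQ_inverse_real_of_nat)
  ultimately have "(norm (x - p))\<^sup>2 \<le> D + 0"
    by (rule LIMSEQ_le) (use y(2) less_imp_le in blast)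
  then have "norm (x - p) \<le> norm (x - v)" if "v \<in> V" for v
    using D[OF that] by (intro power2_le_imp_le[OF _ norm_ge_zero]) linarith
  then show ?thesis using \<open>p \<in> V\<close> by blast
qed

lemma orthogonal_decomposition:
  fixes x :: "'a::chilbert_space"
  assumes "closed V" "csubspace V"
  obtains p where "p \<in> V" "\<And>v. v \<in> V \<Longrightarrow> cinner (x - p) v = 0"
proof -
  obtain p where p: "p \<in> V" "\<And>v. v \<in> V \<Longrightarrow> norm (x - p) \<le> norm (x - v)"
    using nearest_point_exists[OF assms] by blast
  have "cinner (x - p) v = 0" if "v \<in> V" for v
  proof (rule orthogonal_if_minimal)
    fix c
    have "p + c *\<^sub>C v \<in> V" using p(1) that csubspaceD[OF assms(2)] by blast
    from p(2)[OF this] show "norm (x - p) \<le> norm (x - p - c *\<^sub>C v)"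
      by (simp add: algebra_simps)
  qed
  then show thesis using that p(1) by blast
qed

text \<open>Uniqueness of the decomposition makes the chosen map additive and homogeneous. Its bound
  is Cauchy-Schwarz applied to \<open>cinner (P x) (P x) = cinner x (P x)\<close>.\<close>

lemma orthogonal_projection_exists:
  assumes "closed V" "csubspace V"
  obtains P :: "'a::chilbert_space \<Rightarrow> 'a" where "bounded_clinear P" "range P \<subseteq> V"
    "\<And>x v. v \<in> V \<Longrightarrow> cinner (x - P x) v = 0"
proof -
  note V = csubspaceD[OF assms(2)]
  have "\<exists>p. p \<in> V \<and> (\<forall>v\<in>V. cinner (x - p) v = 0)" for x
    using orthogonal_decomposition[OF assms] by metis
  then obtain P where P: "\<And>x. P x \<in> V" "\<And>x v. v \<in> V \<Longrightarrow> cinner (x - P x) v = 0"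
    by metis
  have unique: "P x = p" if "p \<in> V" "\<And>v. v \<in> V \<Longrightarrow> cinner (x - p) v = 0" for x p
  proof -
    \<comment> \<open>The difference lies in \<open>V\<close> and is orthogonal to \<open>V\<close>,
      hence to itself.\<close>
    have "P x - p \<in> V" using P(1) that(1) V by blast
    then have "cinner ((x - p) - (x - P x)) (P x - p) = 0"
      by (simp only: cinner.diff_left[of "x - p"] that(2) P(2)) simp
    then show ?thesis by (simp add: cinner_eq_zero_iff)
  qed
  have "bounded_clinear P"
  proof (rule bounded_clinear_intro)
    fix x y
    show "P (x + y) = P x + P y"
    proof (rule unique)
      fix v assume v: "v \<in> V"
      have "x + y - (P x + P y) = (x - P x) + (y - P y)" by simp
      then show "cinner (x + y - (P x + P y)) v = 0"
        using P(2)[OF v, of x] P(2)[OF v, of y] by (simp only: cinner.add_left) simp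
    qed (intro V P)
  next
    fix c x
    show "P (c *\<^sub>C x) = c *\<^sub>C P x"
    proof (rule unique)
      fix v assume v: "v \<in> V"
      have "c * cinner (x - P x) v = 0" using P(2)[OF v, of x] by simp
      then show "cinner (c *\<^sub>C x - c *\<^sub>C P x) v = 0"
        by (simp add: cinner.diff_left cinner.scale_left algebra_simps)
    qed (intro V P)
  next
    fix x
    have "cinner (P x) (P x) = cinner x (P x)"
      using P(2)[OF P(1), of x x] by (simp add: cinner.diff_left)
    then have "norm (P x) * norm (P x) \<le> norm x * norm (P x)"
      using cinner.cauchy_schwarz[of x "P x"] cinner.self_eq_seminorm[of "P x"]
      by (metis norm_of_real abs_of_nonneg power2_eq_square zero_le_power2)
    then show "norm (P x) \<le> norm x * 1"
      by (cases "P x = 0") simp_all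
  qed
  then show thesis using that P by blast
qed

text \<open>Let \<open>z\<close> be orthogonal to the kernel of \<open>\<phi>\<close>. The vector
  \<open>\<phi> x *\<^sub>C z - \<phi> z *\<^sub>C x\<close> lies in that kernel, and pairing it
  with \<open>z\<close> can be solved for \<open>\<phi> x\<close>.\<close>

lemma riesz_representation:
  fixes \<phi> :: "'a::chilbert_space \<Rightarrow> complex"
  assumes lin: "bounded_linear \<phi>" and scale: "\<And>c x. \<phi> (c *\<^sub>C x) = c * \<phi> x"
  shows "\<exists>y. \<forall>x. \<phi> x = cinner x y"
proof (cases "\<forall>x. \<phi> x = 0")
  case True
  then show ?thesis by (intro exI[of _ 0]) (simp add: cinner.zero_right)
next
  case False
  then obtain z0 where z0: "\<phi> z0 \<noteq> 0" by blast
  define V where "V = {x. \<phi> x = 0}"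
  have "closed V"
  proof -
    have "V = \<phi> -` {0}" by (auto simp: V_def)
    then show ?thesis
      using continuous_closed_vimage[of "{0}" \<phi>] linear_continuous_at[OF lin] by simp
  qed
  moreover have "csubspace V"
    using lin by (auto simp: csubspace_def V_def linear_simps scale)
  ultimately obtain p where p: "p \<in> V" "\<And>v. v \<in> V \<Longrightarrow> cinner (z0 - p) v = 0"
    using orthogonal_decomposition by metis
  define z where "z = z0 - p"
  have z: "\<phi> z \<noteq> 0" using z0 p(1) lin by (simp add: z_def V_def linear_simps)
  then have nz: "cinner z z \<noteq> 0"
    using lin by (auto simp: cinner_eq_zero_iff linear_simps)
  have "\<phi> x = cinner x (cnj (\<phi> z / cinner z z) *\<^sub>C z)" for x
  proof -
    have "\<phi> x *\<^sub>C z - \<phi> z *\<^sub>C x \<in> V"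
      using lin by (simp add: V_def linear_simps scale)
    then have "cinner z (\<phi> x *\<^sub>C z - \<phi> z *\<^sub>C x) = 0"
      using p(2) by (simp add: z_def)
    then have "cinner (\<phi> x *\<^sub>C z - \<phi> z *\<^sub>C x) z = 0"
      by (metis cinner_commute complex_cnj_zero)
    then show ?thesis
      using nz by (simp add: cinner.diff_left cinner.scale_left cinner.scale_right field_simps)
  qed
  then show ?thesis by blast
qed

text \<open>Riesz representation of \<open>x \<mapsto> cinner (T x) y\<close> yields
  \<open>S y\<close>. The bound on \<open>S\<close> follows from
  \<open>cinner (S x) (S x) = cinner (T (S x)) x\<close>.\<close>

lemma cadjoint_exists:
  fixes T :: "'a::chilbert_space \<Rightarrow> 'a"
  assumes T: "bounded_clinear T"
  shows "\<exists>S. bounded_clinear S \<and> (\<forall>x y. cinner (T x) y = cinner x (S y))"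
proof -
  note T_simps = bounded_clinearD[OF T]
  obtain K where K: "\<And>x. norm (T x) \<le> norm x * K"
    using bounded_linear.bounded[OF T_simps(4)] by blast
  have "\<exists>z. \<forall>x. cinner (T x) y = cinner x z" for y
  proof (rule riesz_representation)
    show "bounded_linear (\<lambda>x. cinner (T x) y)"
    proof (rule bounded_linear_intro)
      fix x
      have "cmod (cinner (T x) y) \<le> norm (T x) * norm y"
        by (rule cinner.cauchy_schwarz)
      also have "\<dots> \<le> norm x * K * norm y"
        by (simp add: K mult_right_mono)
      finally show "norm (cinner (T x) y) \<le> norm x * (K * norm y)"
        by (simp add: mult.assoc)
    qed (simp_all add: T_simps cinner.add_left cinner.scale_left scaleR_scaleC scaleC_complex_def)
  qed (simp add: T_simps cinner.scale_left)
  then obtain S where S: "\<And>x y. cinner (T x) y = cinner x (S y)"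
    by metis
  have "bounded_clinear S"
  proof (rule bounded_clinear_intro)
    show "S (x + y) = S x + S y" for x y
      by (rule cinner_eqI) (simp add: cinner.add_right S[symmetric])
    show "S (c *\<^sub>C x) = c *\<^sub>C S x" for c x
      by (rule cinner_eqI) (simp add: cinner.scale_right S[symmetric])
    fix x
    have "norm (S x) * norm (S x) = cmod (cinner (T (S x)) x)"
      unfolding S by (simp add: cinner.self_eq_seminorm power2_eq_square norm_mult)
    also have "\<dots> \<le> norm (T (S x)) * norm x"
      by (rule cinner.cauchy_schwarz)
    also have "\<dots> \<le> norm (S x) * K * norm x"
      by (simp add: K mult_right_mono)
    finally have "norm (S x) * norm (S x) \<le> norm (S x) * (norm x * K)"
      by (simp add: mult_ac)
    moreover have "0 \<le> norm x * K"
      using K[of x] norm_ge_zero order_trans by blast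
    ultimately show "norm (S x) \<le> norm x * K"
      by (cases "S x = 0") simp_all
  qed
  then show ?thesis using S by blast
qed

lemma cinner_cadjoint:
  fixes T :: "'a::chilbert_space \<Rightarrow> 'a"
  assumes "bounded_clinear T"
  shows "cinner (T x) y = cinner x (cadjoint T y)"
proof -
  have "\<exists>!S. bounded_clinear S \<and> (\<forall>x y. cinner (T x) y = cinner x (S y))"
  proof (rule ex_ex1I[OF cadjoint_exists[OF assms]])
    fix S S' assume S: "bounded_clinear S \<and> (\<forall>x y. cinner (T x) y = cinner x (S y))"
      "bounded_clinear S' \<and> (\<forall>x y. cinner (T x) y = cinner x (S' y))"
    have "S y = S' y" for y by (rule cinner_eqI) (metis S)
    then show "S = S'" by blast
  qed
  from theI'[OF this, folded cadjoint_def] show ?thesis by blast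
qed

section \<open>The semi-inner product of a positive operator\<close>

locale positive_operator =
  fixes A :: "'a::chilbert_space \<Rightarrow> 'a"
  assumes positive: "positive_op A"
begin

lemma bounded_clinear_A: "bounded_clinear A"
  using positive by (simp add: positive_op_def)

lemmas A_simps = bounded_clinearD[OF bounded_clinear_A]

text \<open>The quadratic form of \<open>A\<close> is real, which over complex scalars forces
  symmetry: the vector \<open>x + y\<close> settles the imaginary parts and
  \<open>x + \<i> *\<^sub>C y\<close> the real parts.\<close>

lemma A_symmetric: "cinner (A x) y = cnj (cinner (A y) x)"
proof -
  have real: "Im (cinner (A z) z) = 0" for z
    using positive by (auto simp: positive_op_def complex_nonneg_Reals_iff)
  have "Im (cinner (A x) y) + Im (cinner (A y) x) = 0"
    using real[of "x + y"] real[of x] real[of y]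
    by (simp add: A_simps cinner.add_left cinner.add_right)
  moreover have "Re (cinner (A y) x) - Re (cinner (A x) y) = 0"
    using real[of "x + \<i> *\<^sub>C y"] real[of x] real[of y]
    by (simp add: A_simps cinner.add_left cinner.add_right cinner.scale_left cinner.scale_right)
  ultimately show ?thesis by (simp add: complex_eq_iff)
qed

sublocale A: semi_inner "A_inner A"
  rewrites seminorm_A: "semi_inner.seminorm (A_inner A) = A_seminorm A"
proof -
  show *: "semi_inner (A_inner A)"
  proof
    show "A_inner A x y = cnj (A_inner A y x)" for x y
      unfolding A_inner_def by (rule A_symmetric)
    show "0 \<le> Re (A_inner A x x)" for x
      using positive by (auto simp: positive_op_def A_inner_def complex_nonneg_Reals_iff)
  qed (simp_all add: A_inner_def A_simps cinner.add_left cinner.scale_left)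
  show "semi_inner.seminorm (A_inner A) = A_seminorm A"
    by (rule ext) (simp add: semi_inner.seminorm_def[OF *] A_seminorm_def)
qed

text \<open>Symmetry handles the range, continuity of \<open>cinner\<close> its closure. A kernel
  vector in the closure is thus zero, which makes the reduced solution unique.\<close>

lemma ker_orthogonal_closure_range:
  assumes "A x = 0" "y \<in> closure (range A)"
  shows "cinner x y = 0"
proof -
  obtain u where u: "\<And>n. u n \<in> range A" "u \<longlonglongrightarrow> y"
    using assms(2) unfolding closure_sequential by metis
  have zero: "cinner x (u n) = 0" for n
  proof -
    obtain w where w: "u n = A w" using u(1) by auto
    have "cinner (A w) x = 0"
      using A_symmetric[of w x] assms(1) by (simp add: cinner.zero_left)
    then show ?thesis using cinner_commute[of x "A w"] w by simp
  qed
  have "cmod (cinner x y) \<le> norm x * norm (y - u n)" for n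
    using cinner.cauchy_schwarz[of x "y - u n"] by (simp add: cinner.diff_right zero)
  moreover have "(\<lambda>n. norm x * norm (y - u n)) \<longlonglongrightarrow> norm x * norm (y - y)"
    by (intro tendsto_intros u(2))
  ultimately have "cmod (cinner x y) \<le> norm x * norm (y - y)"
    using LIMSEQ_le_const by blast
  then show ?thesis by simp
qed

text \<open>Composing any solution \<open>R\<close> with the orthogonal projection \<open>P\<close>
  onto the closure of the range gives the reduced solution, since \<open>P\<close> changes vectors
  only by elements of the kernel of \<open>A\<close>.\<close>

lemma A_sharp_solution:
  assumes "T \<in> A_adjointable A"
  shows "bounded_clinear (A_sharp A T)" "A (A_sharp A T x) = cadjoint T (A x)"
proof -
  obtain R where R: "bounded_clinear R" "A \<circ> R = cadjoint T \<circ> A"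
    using assms by (auto simp: A_adjointable_def)
  have sub: "csubspace (closure (range A))"
    by (rule csubspace_closure_range[OF bounded_clinear_A])
  obtain P where P: "bounded_clinear P" "range P \<subseteq> closure (range A)"
    "\<And>x v. v \<in> closure (range A) \<Longrightarrow> cinner (x - P x) v = 0"
    using orthogonal_projection_exists[OF closed_closure sub] by metis
  \<comment> \<open>The vector \<open>x - P x\<close> is orthogonal to the range of
    \<open>A\<close>, so by symmetry \<open>A\<close> annihilates it.\<close>
  have AP: "A (P x) = A x" for x
  proof -
    have "cinner (A (x - P x)) y = 0" for y
    proof -
      have "A y \<in> closure (range A)" using closure_subset[of "range A"] by auto
      from P(3)[OF this, of x] have "cinner (A y) (x - P x) = 0"
        using cinner_commute[of "A y" "x - P x"] by simp
      then show ?thesis using A_symmetric[of "x - P x" y] by simp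
    qed
    from this[of "A (x - P x)"] have "A (x - P x) = 0" by (simp add: cinner_eq_zero_iff)
    then show ?thesis by (simp add: A_simps)
  qed
  have "\<exists>!X. bounded_clinear X \<and> A \<circ> X = cadjoint T \<circ> A \<and> range X \<subseteq> closure (range A)"
  proof (rule ex1I[of _ "\<lambda>x. P (R x)"])
    show "bounded_clinear (\<lambda>x. P (R x)) \<and> A \<circ> (\<lambda>x. P (R x)) = cadjoint T \<circ> A \<and>
      range (\<lambda>x. P (R x)) \<subseteq> closure (range A)"
      using P R by (auto simp: AP fun_eq_iff bounded_clinear_compose)
  next
    fix X assume X: "bounded_clinear X \<and> A \<circ> X = cadjoint T \<circ> A \<and> range X \<subseteq> closure (range A)"
    have "X x = P (R x)" for x
    proof -
      have "A (X x - P (R x)) = 0"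
        using X R(2) by (simp add: A_simps AP fun_eq_iff)
      moreover have "X x - P (R x) \<in> closure (range A)"
        using X P(2) by (intro csubspaceD(4)[OF sub]) auto
      ultimately have "cinner (X x - P (R x)) (X x - P (R x)) = 0"
        by (rule ker_orthogonal_closure_range)
      then show ?thesis by (simp add: cinner_eq_zero_iff)
    qed
    then show "X = (\<lambda>x. P (R x))" by blast
  qed
  from theI'[OF this, folded A_sharp_def]
  show "bounded_clinear (A_sharp A T)" "A (A_sharp A T x) = cadjoint T (A x)"
    by (simp_all add: fun_eq_iff)
qed

text \<open>Applying \<open>A\<close> turns \<open>A_sharp A T\<close> into
  \<open>cadjoint T\<close>, to which the adjoint rule of \<open>cinner\<close> applies up to
  conjugation.\<close>

lemma A_inner_sharp_left:
  assumes "T \<in> A_adjointable A"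
  shows "A_inner A (A_sharp A T x) y = A_inner A x (T y)"
proof -
  have "bounded_clinear T" using assms by (simp add: A_adjointable_def)
  then have "cinner (T y) (A x) = cinner y (cadjoint T (A x))"
    by (rule cinner_cadjoint)
  then show ?thesis
    unfolding A_inner_def A_sharp_solution(2)[OF assms]
    using cinner_commute[of "cadjoint T (A x)" y] cinner_commute[of "A x" "T y"] by simp
qed

lemma A_inner_sharp_right:
  assumes "T \<in> A_adjointable A"
  shows "A_inner A x (A_sharp A T y) = A_inner A (T x) y"
  using A.commute[of x "A_sharp A T y"] A.commute[of y "T x"]
  by (simp add: A_inner_sharp_left[OF assms])

section \<open>Finiteness of the numerical radius\<close>

lemma A_seminorm_le: "\<exists>C. \<forall>x. A_seminorm A x \<le> C * norm x"
proof -
  obtain K where K: "\<And>x. norm (A x) \<le> norm x * K" "0 < K"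
    using bounded_linear.pos_bounded[OF A_simps(4)] by blast
  have "A_seminorm A x \<le> sqrt K * norm x" for x
  proof -
    have "(A_seminorm A x)\<^sup>2 \<le> cmod (cinner (A x) x)"
      unfolding A.seminorm_squared A_inner_def by (rule complex_Re_le_cmod)
    also have "\<dots> \<le> norm (A x) * norm x" by (rule cinner.cauchy_schwarz)
    also have "\<dots> \<le> norm x * K * norm x" by (simp add: K mult_right_mono)
    also have "\<dots> = (sqrt K * norm x)\<^sup>2"
      using K(2) by (simp add: power_mult_distrib) (simp add: power2_eq_square)
    finally show ?thesis
      by (rule power2_le_imp_le) (use K(2) in simp)
  qed
  then show ?thesis by blast
qed

text \<open>A norm bound for \<open>S\<close> does not transfer directly, as
  \<open>A_seminorm A x\<close> does not control \<open>norm x\<close>. It does bound the growth of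
  the powers of \<open>S\<close> up to a factor depending on \<open>x\<close>, and
  \<open>seminorm_symmetric_bound\<close> keeps only the rate \<open>K\<close>, which is uniform in
  \<open>x\<close>.\<close>

lemma symmetric_A_bounded:
  assumes S: "bounded_clinear S" and symmetric: "\<And>x y. A_inner A (S x) y = A_inner A x (S y)"
  shows "\<exists>K. \<forall>x. A_seminorm A x = 1 \<longrightarrow> A_seminorm A (S x) \<le> K"
proof -
  obtain K where K: "\<And>x. norm (S x) \<le> norm x * K" "0 < K"
    using bounded_linear.pos_bounded[OF bounded_clinearD(4)[OF S]] by blast
  obtain C0 where "\<And>x. A_seminorm A x \<le> C0 * norm x"
    using A_seminorm_le by blast
  then have C: "A_seminorm A x \<le> \<bar>C0\<bar> * norm x" for x
    by (meson abs_ge_self mult_right_mono norm_ge_zero order_trans)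
  have growth: "norm ((S ^^ n) x) \<le> norm x * K ^ n" for n x
  proof (induction n)
    case (Suc n)
    have "norm ((S ^^ Suc n) x) \<le> norm ((S ^^ n) x) * K" by (simp add: K)
    also have "\<dots> \<le> norm x * K ^ n * K" using Suc K(2) by (simp add: mult_right_mono)
    finally show ?case by (simp add: mult_ac)
  qed simp
  have "A_seminorm A (S x) \<le> K" if "A_seminorm A x = 1" for x
  proof (rule A.seminorm_symmetric_bound[OF symmetric _ K(2) that])
    fix n
    have "A_seminorm A ((S ^^ n) x) \<le> \<bar>C0\<bar> * norm ((S ^^ n) x)" by (rule C)
    also have "\<dots> \<le> \<bar>C0\<bar> * (norm x * K ^ n)"
      by (simp add: growth mult_left_mono)
    finally show "A_seminorm A ((S ^^ n) x) \<le> (\<bar>C0\<bar> * norm x) * K ^ n"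
      by (simp add: mult.assoc)
  qed
  then show ?thesis by blast
qed

text \<open>The square of \<open>A_seminorm A (T x)\<close> is the quadratic form of the symmetric
  operator \<open>S\<close> at \<open>x\<close>, so a bound for \<open>S\<close> on unit vectors
  yields one for \<open>T\<close>. It makes the supremum in \<open>A_numerical_radius\<close> a true
  upper bound.\<close>

lemma A_numerical_range_bounded:
  assumes "T \<in> A_adjointable A"
  shows "bdd_above (cmod ` A_numerical_range A T)"
proof -
  define S where "S = (\<lambda>x. A_sharp A T (T x))"
  have "bounded_clinear S"
    unfolding S_def using assms A_sharp_solution(1)[OF assms]
    by (auto simp: A_adjointable_def intro: bounded_clinear_compose[of "A_sharp A T" T])
  moreover have "A_inner A (S x) y = A_inner A x (S y)" for x y
    by (simp add: S_def A_inner_sharp_left[OF assms] A_inner_sharp_right[OF assms])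
  ultimately obtain K where K: "\<And>x. A_seminorm A x = 1 \<Longrightarrow> A_seminorm A (S x) \<le> K"
    using symmetric_A_bounded by blast
  have "cmod (A_inner A (T x) x) \<le> sqrt K" if x: "A_seminorm A x = 1" for x
  proof (rule real_le_rsqrt)
    have "cmod (A_inner A (T x) x) \<le> A_seminorm A (T x)"
      using A.cauchy_schwarz[of "T x" x] x by simp
    then have "(cmod (A_inner A (T x) x))\<^sup>2 \<le> (A_seminorm A (T x))\<^sup>2"
      by (simp add: power_mono)
    also have "\<dots> = Re (A_inner A (S x) x)"
      by (simp add: A.seminorm_squared S_def A_inner_sharp_left[OF assms])
    also have "\<dots> \<le> A_seminorm A (S x)"
      using A.cauchy_schwarz[of "S x" x] complex_Re_le_cmod[of "A_inner A (S x) x"] x by simp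
    also have "\<dots> \<le> K" using K x by blast
    finally show "(cmod (A_inner A (T x) x))\<^sup>2 \<le> K" .
  qed
  then show ?thesis
    by (intro bdd_aboveI2[of _ _ "sqrt K"]) (auto simp: A_numerical_range_def)
qed

text \<open>A bound valid for all vectors passes to the supremum of the quotients. Nonnegativity is
  recorded because the norm is squared later.\<close>

lemma A_norm_bounds:
  assumes "\<And>x. A_seminorm A (S x) \<le> M * A_seminorm A x" "0 \<le> M"
  shows "0 \<le> A_norm A S" "A_norm A S \<le> M"
proof -
  define Q where "Q = {A_seminorm A (S x) / A_seminorm A x | x. x \<in> closure (range A) \<and> x \<noteq> 0}"
  have Q: "0 \<le> q" "q \<le> M" if "q \<in> Q" for q
  proof -
    obtain x where x: "q = A_seminorm A (S x) / A_seminorm A x"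
      using \<open>q \<in> Q\<close> by (auto simp: Q_def)
    show "0 \<le> q" by (simp add: x A.seminorm_nonneg)
    \<comment> \<open>If the denominator vanishes, the quotient is \<open>0\<close> by convention,
      and \<open>0 \<le> M\<close> closes the case.\<close>
    show "q \<le> M"
      using assms(1)[of x] assms(2) A.seminorm_nonneg[of x]
      by (cases "A_seminorm A x = 0") (auto simp: x field_simps)
  qed
  have norm: "A_norm A S = (if Q = {} then 0 else Sup Q)"
    unfolding A_norm_def Let_def Q_def by (rule refl)
  have bdd: "bdd_above Q" using Q(2) by (rule bdd_aboveI)
  show "0 \<le> A_norm A S"
  proof (cases "Q = {}")
    case False
    then obtain q where q: "q \<in> Q" by blast
    then have "q \<le> Sup Q" using bdd by (rule cSup_upper)
    then show ?thesis using Q(1)[OF q] norm False by simp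
  qed (simp add: norm)
  show "A_norm A S \<le> M"
    using norm assms(2) cSup_least[of Q M] Q(2) by auto
qed

section \<open>Real and imaginary parts of an operator\<close>

lemma A_inner_Re_A:
  assumes "T \<in> A_adjointable A"
  shows "A_inner A (Re_A A T x) x = complex_of_real (Re (A_inner A (T x) x))"
  using A.commute[of x "T x"]
  by (simp add: Re_A_def A.scale_left A.add_left A_inner_sharp_left[OF assms] complex_eq_iff)

text \<open>The quadratic form of \<open>A_sharp A T\<close> is the conjugate of that of
  \<open>T\<close>, so the difference divided by \<open>2 * \<i>\<close> leaves the imaginary part,
  just as the half sum leaves the real part.\<close>

lemma A_inner_Im_A:
  assumes "T \<in> A_adjointable A"
  shows "A_inner A (Im_A A T x) x = complex_of_real (Im (A_inner A (T x) x))"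
proof -
  have "A_inner A (T x) x - A_inner A x (T x) = complex_of_real (2 * Im (A_inner A (T x) x)) * \<i>"
    using A.commute[of x "T x"] complex_diff_cnj[of "A_inner A (T x) x"] by simp
  then show ?thesis
    by (simp add: Im_A_def A.scale_left A.diff_left A_inner_sharp_left[OF assms] field_simps)
qed

text \<open>Passing to the other argument flips the sign of \<open>T - A_sharp A T\<close> and, by
  conjugation, of the factor \<open>1 / (2 * \<i>)\<close>; the two signs cancel.\<close>

lemma Im_A_symmetric:
  assumes "T \<in> A_adjointable A"
  shows "A_inner A (Im_A A T x) y = A_inner A x (Im_A A T y)"
proof -
  have "cnj (1 / (2 * \<i>)) = - (1 / (2 * \<i>))" by simp
  then show ?thesis
    unfolding Im_A_def A.scale_left A.scale_right A.diff_left A.diff_right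
      A_inner_sharp_left[OF assms] A_inner_sharp_right[OF assms]
    by (simp only: mult_minus_left mult_minus_right distrib_left diff_conv_add_uminus minus_minus
        add.commute)
qed

lemma Im_A_add:
  assumes "T \<in> A_adjointable A"
  shows "Im_A A T (x + y) = Im_A A T x + Im_A A T y"
proof -
  have "bounded_clinear T" using assms by (simp add: A_adjointable_def)
  note simps = bounded_clinearD[OF this] bounded_clinearD[OF A_sharp_solution(1)[OF assms]]
  show ?thesis
    unfolding Im_A_def scaleC_add_right[symmetric] by (simp add: simps algebra_simps)
qed

text \<open>The unit vector \<open>x\<close> makes the numerical range nonempty, so
  \<open>A_crawford\<close> is a genuine infimum and not the default \<open>0\<close>.\<close>

lemma crawford_Re_A_le:
  assumes T: "T \<in> A_adjointable A" and x: "A_seminorm A x = 1"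
  shows "0 \<le> A_crawford A (Re_A A T)" "A_crawford A (Re_A A T) \<le> \<bar>Re (A_inner A (T x) x)\<bar>"
proof -
  have mem: "A_inner A (Re_A A T x) x \<in> A_numerical_range A (Re_A A T)"
    using x by (auto simp: A_numerical_range_def)
  then have c: "A_crawford A (Re_A A T) = (INF z\<in>A_numerical_range A (Re_A A T). cmod z)"
    by (auto simp: A_crawford_def)
  show "0 \<le> A_crawford A (Re_A A T)"
    unfolding c using mem by (intro cINF_greatest) auto
  have "bdd_below (cmod ` A_numerical_range A (Re_A A T))"
    by (rule bdd_belowI2[of _ 0]) simp
  from cINF_lower[OF this mem] show "A_crawford A (Re_A A T) \<le> \<bar>Re (A_inner A (T x) x)\<bar>"
    unfolding c A_inner_Re_A[OF T] by simp
qed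

lemma cmod_le_A_numerical_radius:
  assumes T: "T \<in> A_adjointable A" and x: "A_seminorm A x = 1"
  shows "cmod (A_inner A (T x) x) \<le> A_numerical_radius A T"
proof -
  have mem: "A_inner A (T x) x \<in> A_numerical_range A T"
    using x by (auto simp: A_numerical_range_def)
  then have "A_numerical_radius A T = (SUP z\<in>A_numerical_range A T. cmod z)"
    by (auto simp: A_numerical_radius_def)
  then show ?thesis
    using cSUP_upper[OF mem A_numerical_range_bounded[OF T]] by simp
qed

text \<open>Both sides scale quadratically, so normalization reduces to unit vectors. Null vectors
  cannot be normalized; for them Cauchy-Schwarz makes the left side vanish.\<close>

lemma A_homogeneous_bound:
  assumes S: "\<And>x y. A_inner A (S x) y = A_inner A x (S y)"
    and scale: "\<And>r x. S (r *\<^sub>R x) = r *\<^sub>R S x"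
    and unit: "\<And>x. A_seminorm A x = 1 \<Longrightarrow> \<bar>Re (A_inner A (S x) x)\<bar> \<le> M"
  shows "\<bar>Re (A_inner A (S x) x)\<bar> \<le> M * (A_seminorm A x)\<^sup>2"
proof (cases "A_seminorm A x = 0")
  case True
  then show ?thesis
    using A.cauchy_schwarz[of "S x" x] abs_Re_le_cmod[of "A_inner A (S x) x"] by simp
next
  case False
  define r where "r = A_seminorm A x"
  have r: "0 < r" using False A.seminorm_nonneg[of x] by (simp add: r_def)
  define u where "u = inverse r *\<^sub>R x"
  have "A_seminorm A u = 1" using r by (simp add: u_def A.seminorm_scaleR flip: r_def)
  moreover have x: "x = r *\<^sub>R u" using r by (simp add: u_def)
  have "Re (A_inner A (S x) x) = r\<^sup>2 * Re (A_inner A (S u) u)"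
    by (simp add: x scale)
      (simp add: scaleR_scaleC A.scale_left A.scale_right power2_eq_square)
  ultimately show ?thesis
    using unit[of u] r by (simp add: abs_mult r_def[symmetric] mult.commute mult_left_mono)
qed

lemma Im_A_scaleR:
  assumes "T \<in> A_adjointable A"
  shows "Im_A A T (r *\<^sub>R x) = r *\<^sub>R Im_A A T x"
proof -
  have "bounded_clinear T" using assms by (simp add: A_adjointable_def)
  note simps = bounded_clinearD[OF this] bounded_clinearD[OF A_sharp_solution(1)[OF assms]]
  have "T (r *\<^sub>R x) - A_sharp A T (r *\<^sub>R x) = r *\<^sub>R (T x - A_sharp A T x)"
    using simps by (simp add: linear_simps scaleR_diff_right)
  then show ?thesis
    unfolding Im_A_def by (simp only: scaleR_scaleC scaleC_scaleC mult.commute)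
qed

end

section \<open>From unit vectors to the seminorm of \<open>Im_A\<close>, and the final
  estimate\<close>

theorem theorem2:
  fixes A T :: "'a::chilbert_space \<Rightarrow> 'a"
  assumes "\<exists>x::'a. x \<noteq> 0"
    and "positive_op A"
    and "T \<in> A_adjointable A"
  shows "A_numerical_radius A T \<ge> sqrt ((A_norm A (Im_A A T))\<^sup>2 + (A_crawford A (Re_A A T))\<^sup>2)"
proof -
  interpret positive_operator A by unfold_locales (rule assms(2))
  note T = assms(3)
  define w where "w = A_numerical_radius A T"
  define m where "m = A_crawford A (Re_A A T)"
  \<comment> \<open>The squared modulus splits into real and imaginary parts; \<open>m\<close>
    bounds the real part from below and \<open>w\<close> the modulus from above.\<close>
  have unit: "0 \<le> m \<and> 0 \<le> w \<and> (Im (A_inner A (T x) x))\<^sup>2 + m\<^sup>2 \<le> w\<^sup>2" if x: "A_seminorm A x = 1" for x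
  proof -
    have m: "0 \<le> m" "m \<le> \<bar>Re (A_inner A (T x) x)\<bar>"
      using crawford_Re_A_le[OF T x] by (simp_all add: m_def)
    have w: "cmod (A_inner A (T x) x) \<le> w"
      using cmod_le_A_numerical_radius[OF T x] by (simp add: w_def)
    have "m\<^sup>2 \<le> (Re (A_inner A (T x) x))\<^sup>2"
      using m power_mono[of m _ 2] by fastforce
    moreover have "(cmod (A_inner A (T x) x))\<^sup>2 \<le> w\<^sup>2"
      using w by (simp add: power_mono)
    moreover have "0 \<le> w" using w norm_ge_zero order_trans by blast
    ultimately show ?thesis using m(1) by (simp add: cmod_power2)
  qed
  have mw: "m\<^sup>2 \<le> w\<^sup>2 \<and> 0 \<le> w"
  proof (cases "\<exists>x. A_seminorm A x = 1")
    case True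
    then obtain x where "A_seminorm A x = 1" by blast
    then show ?thesis using unit[of x] zero_le_power2[of "Im (A_inner A (T x) x)"] by linarith
  next
    \<comment> \<open>Without vectors of seminorm \<open>1\<close> the numerical ranges are empty,
      and \<open>m\<close> and \<open>w\<close> both take the default \<open>0\<close>.\<close>
    case False
    then show ?thesis
      by (simp add: m_def w_def A_crawford_def A_numerical_radius_def A_numerical_range_def)
  qed
  \<comment> \<open>This is the room that \<open>w\<close> and \<open>m\<close> leave for the
    imaginary part; \<open>mw\<close> keeps the radicand nonnegative.\<close>
  define M where "M = sqrt (w\<^sup>2 - m\<^sup>2)"
  have M: "0 \<le> M" using mw by (simp add: M_def)
  have "\<bar>Re (A_inner A (Im_A A T x) x)\<bar> \<le> M" if x: "A_seminorm A x = 1" for x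
  proof -
    have "\<bar>Im (A_inner A (T x) x)\<bar> \<le> M"
      unfolding M_def using unit[OF x] by (intro real_le_rsqrt) simp
    then show ?thesis by (simp add: A_inner_Im_A[OF T])
  qed
  \<comment> \<open>Homogeneity extends the bound to all vectors; symmetry then lifts it from the
    quadratic form to the seminorm of \<open>Im_A A T x\<close>.\<close>
  then have "\<bar>Re (A_inner A (Im_A A T x) x)\<bar> \<le> M * (A_seminorm A x)\<^sup>2" for x
    using A_homogeneous_bound[OF Im_A_symmetric[OF T] Im_A_scaleR[OF T]] by blast
  then have "A_seminorm A (Im_A A T x) \<le> M * A_seminorm A x" for x
    by (rule A.seminorm_le_if_numerical_le[OF Im_A_symmetric[OF T] Im_A_add[OF T]])
  note N = A_norm_bounds[OF this M]
  have "(A_norm A (Im_A A T))\<^sup>2 \<le> M\<^sup>2"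
    using N by (simp add: power_mono)
  then have "(A_norm A (Im_A A T))\<^sup>2 + m\<^sup>2 \<le> w\<^sup>2"
    using mw by (simp add: M_def)
  then show ?thesis
    using mw unfolding m_def[symmetric] w_def[symmetric] by (simp add: real_le_lsqrt)
qed

end
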